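(* Every bornologous map $\phi\colon c_0\to E$ into a reflexive Banach space $E$ is insolvent.
   Context: A map $\phi\colon (X,d)\to (Y,\partial)$ between metric spaces is bornologous if $\sup\{\partial(\phi(a),\phi(b)):d(a,b)\leqslant t\}<\infty$ for all $t<\infty$. It is solvent if for every $n\geqslant1$ there is a constant $R$ such that $R\leqslant d(x,y)\leqslant R+n$ implies $\partial(\phi(x),\phi(y))\geqslant n$; it is insolvent if it is not solvent. Banach spaces carry their norm metric. *)

theory Defs
  imports "HOL-Analysis.Analysis"
begin

definition bornologous_on :: "'a::metric_space set \<Rightarrow> ('a \<Rightarrow> 'b::metric_space) \<Rightarrow> bool" where
  "bornologous_on X \<phi> \<longleftrightarrow>
    (\<forall>t::real. bdd_above {dist (\<phi> a) (\<phi> b) | a b. a \<in> X \<and> b \<in> X \<and> dist a b \<le> t})"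

text \<open>The constant \<open>R\<close> is a distance, hence nonnegative: with \<open>R < - n\<close> the condition would be
  vacuous and every map would be solvent.\<close>

definition solvent_on :: "'a::metric_space set \<Rightarrow> ('a \<Rightarrow> 'b::metric_space) \<Rightarrow> bool" where
  "solvent_on X \<phi> \<longleftrightarrow>
    (\<forall>n::nat. n \<ge> 1 \<longrightarrow> (\<exists>R::real. R \<ge> 0 \<and>
      (\<forall>x\<in>X. \<forall>y\<in>X. R \<le> dist x y \<and> dist x y \<le> R + real n \<longrightarrow> dist (\<phi> x) (\<phi> y) \<ge> real n)))"

definition insolvent_on :: "'a::metric_space set \<Rightarrow> ('a \<Rightarrow> 'b::metric_space) \<Rightarrow> bool" where
  "insolvent_on X \<phi> \<longleftrightarrow> \<not> solvent_on X \<phi>"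

text \<open>As \<open>nat\<close> is discrete, \<open>nat \<Rightarrow>\<^sub>C real\<close> is the Banach space of all bounded real
  sequences with the supremum norm; \<open>c0\<close> is its closed subspace of null sequences.\<close>

definition c0 :: "(nat \<Rightarrow>\<^sub>C real) set" where
  "c0 = {x. apply_bcontfun x \<longlonglongrightarrow> 0}"

lemma subspace_c0: "subspace c0"
  unfolding subspace_def c0_def
  by (auto simp: plus_bcontfun.rep_eq scaleR_bcontfun.rep_eq zero_bcontfun.rep_eq
      intro: tendsto_add_zero tendsto_mult_right_zero)

lemma closed_c0: "closed c0"
proof (unfold closed_sequential_limits, intro allI impI, elim conjE)
  fix X :: "nat \<Rightarrow> nat \<Rightarrow>\<^sub>C real" and l
  assume X: "\<forall>k. X k \<in> c0" and lim: "X \<longlonglongrightarrow> l"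
  show "l \<in> c0"
    unfolding c0_def mem_Collect_eq
  proof (rule metric_LIMSEQ_I)
    fix e :: real assume "e > 0"
    then obtain k where k: "dist (X k) l < e / 2"
      using metric_LIMSEQ_D[OF lim, of "e / 2"] by auto
    have "apply_bcontfun (X k) \<longlonglongrightarrow> 0"
      using X by (simp add: c0_def)
    then obtain N where N: "\<And>n. n \<ge> N \<Longrightarrow> dist (apply_bcontfun (X k) n) 0 < e / 2"
      using metric_LIMSEQ_D[of "apply_bcontfun (X k)" 0 "e / 2"] \<open>e > 0\<close> by auto
    have "dist (apply_bcontfun l n) 0 < e" if "n \<ge> N" for n
      using N[OF that] k dist_bounded[of "X k" n l]
        dist_triangle[of "apply_bcontfun l n" 0 "apply_bcontfun (X k) n"]
      by (simp add: dist_commute)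
    then show "\<exists>N. \<forall>n\<ge>N. dist (apply_bcontfun l n) 0 < e"
      by blast
  qed
qed

lift_definition bidual_embedding ::
  "'a::real_normed_vector \<Rightarrow> (('a \<Rightarrow>\<^sub>L real) \<Rightarrow>\<^sub>L real)" is "\<lambda>x f. blinfun_apply f x"
  by (rule blinfun.bounded_linear_left)

definition reflexive_space :: "'a::real_normed_vector itself \<Rightarrow> bool" where
  "reflexive_space _ \<longleftrightarrow> surj (bidual_embedding :: 'a \<Rightarrow> (('a \<Rightarrow>\<^sub>L real) \<Rightarrow>\<^sub>L real))"

end

theory Submission
  imports Defs
begin

text \<open>Kalton's interlacing argument. Let \<open>s n\<close> be the indicator of \<open>{..<n}\<close> in \<open>c\<^sub>0\<close> and put
  \<open>f n\<^sub>1 \<dots> n\<^sub>r = \<phi> (s n\<^sub>1 + \<dots> + s n\<^sub>r)\<close>. Interlaced index tuples give points at distance at most \<open>1\<close>,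
  so their \<open>f\<close>-values are within a constant \<open>C\<close> that does not depend on \<open>r\<close>; if instead all
  entries of one tuple lie beyond those of the other, the points are at distance exactly \<open>r\<close>. In a
  reflexive space \<open>f\<close> has an iterated weak generalized limit \<open>u\<close>. Pairing \<open>f - u\<close> with its
  own norming functionals along interlaced tuples gives tuples, as far out as desired, whose
  \<open>f\<close>-values are within \<open>C + 1\<close> of \<open>u\<close>. Two of them give points at distance \<open>r\<close> whose images
  are within \<open>2 * C + 2\<close>, for every \<open>r\<close>.\<close>

section \<open>The Hahn--Banach theorem\<close>

definition sublinear :: "('a::real_vector \<Rightarrow> real) \<Rightarrow> bool" where
  "sublinear p \<longleftrightarrow> (\<forall>x y. p (x + y) \<le> p x + p y) \<and> (\<forall>x c. c \<ge> 0 \<longrightarrow> p (c *\<^sub>R x) = c * p x)"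

lemma sublinear_add: "sublinear p \<Longrightarrow> p (x + y) \<le> p x + p y"
  by (simp add: sublinear_def)

lemma sublinear_scale: "sublinear p \<Longrightarrow> c \<ge> 0 \<Longrightarrow> p (c *\<^sub>R x) = c * p x"
  by (simp add: sublinear_def)

lemma sublinear_zero: "sublinear p \<Longrightarrow> p 0 = 0"
  using sublinear_scale[of p 0 0] by simp

lemma sublinear_ge: "sublinear p \<Longrightarrow> - p (- x) \<le> p x"
  using sublinear_add[of p x "- x"] by (simp add: sublinear_zero)

text \<open>The reverse of the scaling inequality is the same inequality for
  \<open>inverse c\<close>.\<close>

lemma sublinearI:
  fixes p :: "'a::real_vector \<Rightarrow> real"
  assumes add: "\<And>x y. p (x + y) \<le> p x + p y"
    and zero: "p 0 = 0"
    and scale: "\<And>x c. c > 0 \<Longrightarrow> p (c *\<^sub>R x) \<le> c * p x"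
  shows "sublinear p"
proof -
  have "p (c *\<^sub>R x) = c * p x" if "c \<ge> 0" for c x
  proof (cases "c = 0")
    case False
    then have "c > 0" using that by simp
    then have "p x \<le> inverse c * p (c *\<^sub>R x)"
      using scale[of "inverse c" "c *\<^sub>R x"] by simp
    then have "c * p x \<le> p (c *\<^sub>R x)"
      using \<open>c > 0\<close> by (simp add: field_simps)
    with scale[OF \<open>c > 0\<close>, of x] show ?thesis by simp
  qed (simp add: zero)
  then show ?thesis using add by (simp add: sublinear_def)
qed

lemma sublinear_norm: "sublinear (norm :: 'a::real_normed_vector \<Rightarrow> real)"
  by (simp add: sublinear_def norm_triangle_ineq)

text \<open>For sublinear \<open>q\<close>, the largest sublinear functional below \<open>q\<close>
  that is at most \<open>- q y\<close> at \<open>- y\<close>; it is linear along the line through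
  \<open>y\<close>.\<close>

definition linearize_at :: "('a::real_vector \<Rightarrow> real) \<Rightarrow> 'a \<Rightarrow> 'a \<Rightarrow> real" where
  "linearize_at q y x = (INF t\<in>{0..}. q (x + t *\<^sub>R y) - t * q y)"

context
  fixes q :: "'a::real_vector \<Rightarrow> real"
  assumes q: "sublinear q"
begin

lemma linearize_at_lower:
  assumes "t \<ge> 0"
  shows "linearize_at q y x \<le> q (x + t *\<^sub>R y) - t * q y"
proof -
  \<comment> \<open>This bound, uniform in \<open>t\<close>, makes the infimum a genuine
    one.\<close>
  have "- q (- x) \<le> q (x + t *\<^sub>R y) - t * q y" if "t \<ge> 0" for t
    using sublinear_add[OF q, of "x + t *\<^sub>R y" "- x"] sublinear_scale[OF q that, of y] by simp
  then have "bdd_below ((\<lambda>t. q (x + t *\<^sub>R y) - t * q y) ` {0..})"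
    by (intro bdd_belowI[of _ "- q (- x)"]) auto
  then show ?thesis
    unfolding linearize_at_def using assms by (intro cINF_lower) auto
qed

lemma linearize_at_greatest:
  assumes "\<And>t. t \<ge> 0 \<Longrightarrow> m \<le> q (x + t *\<^sub>R y) - t * q y"
  shows "m \<le> linearize_at q y x"
  unfolding linearize_at_def by (rule cINF_greatest) (use assms in auto)

lemma linearize_at_le: "linearize_at q y x \<le> q x"
  using linearize_at_lower[of 0 y x] by simp

lemma linearize_at_uminus: "linearize_at q y (- y) \<le> - q y"
  using linearize_at_lower[of 1 y "- y"] by (simp add: sublinear_zero[OF q])

text \<open>Parameters \<open>t1\<close> and \<open>t2\<close> for two summands add up to a
  parameter for the sum; scaling by \<open>c\<close> turns \<open>t\<close> into
  \<open>c * t\<close>.\<close>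

lemma sublinear_linearize_at: "sublinear (linearize_at q y)"
proof (rule sublinearI)
  fix x1 x2
  have "linearize_at q y (x1 + x2) - (q (x1 + t1 *\<^sub>R y) - t1 * q y) \<le> linearize_at q y x2"
    if "t1 \<ge> 0" for t1
  proof (rule linearize_at_greatest)
    fix t2 :: real assume "t2 \<ge> 0"
    have "linearize_at q y (x1 + x2) \<le> q (x1 + x2 + (t1 + t2) *\<^sub>R y) - (t1 + t2) * q y"
      using that \<open>t2 \<ge> 0\<close> by (intro linearize_at_lower) simp
    moreover have "q (x1 + x2 + (t1 + t2) *\<^sub>R y) \<le> q (x1 + t1 *\<^sub>R y) + q (x2 + t2 *\<^sub>R y)"
      using sublinear_add[OF q, of "x1 + t1 *\<^sub>R y" "x2 + t2 *\<^sub>R y"] by (simp add: algebra_simps)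
    ultimately show "linearize_at q y (x1 + x2) - (q (x1 + t1 *\<^sub>R y) - t1 * q y)
        \<le> q (x2 + t2 *\<^sub>R y) - t2 * q y"
      by (simp add: algebra_simps)
  qed
  then have "linearize_at q y (x1 + x2) - linearize_at q y x2 \<le> linearize_at q y x1"
    by (intro linearize_at_greatest) (simp add: algebra_simps)
  then show "linearize_at q y (x1 + x2) \<le> linearize_at q y x1 + linearize_at q y x2"
    by simp
next
  have "0 \<le> linearize_at q y 0"
    by (rule linearize_at_greatest) (simp add: sublinear_scale[OF q])
  then show "linearize_at q y 0 = 0"
    using linearize_at_le[of y 0] by (simp add: sublinear_zero[OF q])
next
  fix x and c :: real assume c: "c > 0"
  have "inverse c * linearize_at q y (c *\<^sub>R x) \<le> linearize_at q y x"
  proof (rule linearize_at_greatest)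
    fix t :: real assume t: "t \<ge> 0"
    have "linearize_at q y (c *\<^sub>R x) \<le> q (c *\<^sub>R x + (c * t) *\<^sub>R y) - (c * t) * q y"
      using c t by (intro linearize_at_lower) simp
    also have "\<dots> = c * (q (x + t *\<^sub>R y) - t * q y)"
      using sublinear_scale[OF q, of c "x + t *\<^sub>R y"] c by (simp add: algebra_simps)
    finally show "inverse c * linearize_at q y (c *\<^sub>R x) \<le> q (x + t *\<^sub>R y) - t * q y"
      using c by (simp add: field_simps)
  qed
  then show "linearize_at q y (c *\<^sub>R x) \<le> c * linearize_at q y x"
    using c by (simp add: field_simps)
qed

end

text \<open>Provides the bounds of chains for Zorn's lemma. Of two members of a chain the smaller
  serves for both, which keeps the infimum subadditive.\<close>

lemma sublinear_chain_Inf: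
  fixes C :: "('a::real_vector \<Rightarrow> real) set"
  assumes "C \<noteq> {}"
    and sub: "\<And>q. q \<in> C \<Longrightarrow> sublinear q"
    and le: "\<And>q x. q \<in> C \<Longrightarrow> q x \<le> p x"
    and chain: "\<And>q r. q \<in> C \<Longrightarrow> r \<in> C \<Longrightarrow> q \<le> r \<or> r \<le> q"
  defines "u \<equiv> \<lambda>x. INF q\<in>C. q x"
  shows "sublinear u" and "\<And>q. q \<in> C \<Longrightarrow> u \<le> q"
proof -
  have bdd: "bdd_below ((\<lambda>q. q x) ` C)" for x
  proof (rule bdd_belowI2)
    fix q assume "q \<in> C"
    then show "- p (- x) \<le> q x"
      using sublinear_ge[OF sub, of q x] le[of q "- x"] by linarith
  qed
  have lower: "u x \<le> q x" if "q \<in> C" for q x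
    unfolding u_def using bdd that by (rule cINF_lower)
  then show "u \<le> q" if "q \<in> C" for q
    using that by (simp add: le_fun_def)
  have greatest: "m \<le> u x" if "\<And>q. q \<in> C \<Longrightarrow> m \<le> q x" for m x
    unfolding u_def using assms(1) that by (rule cINF_greatest)
  show "sublinear u"
  proof (rule sublinearI)
    fix x y
    have "u (x + y) \<le> q x + r y" if "q \<in> C" "r \<in> C" for q r
    proof -
      obtain s where s: "s \<in> C" "s \<le> q" "s \<le> r"
        using chain[of q r] \<open>q \<in> C\<close> \<open>r \<in> C\<close> by blast
      have "u (x + y) \<le> s x + s y"
        using lower[OF s(1), of "x + y"] sublinear_add[OF sub[OF s(1)], of x y] by linarith
      also have "\<dots> \<le> q x + r y"
        using s by (intro add_mono) (auto simp: le_fun_def)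
      finally show ?thesis .
    qed
    then have "u (x + y) - q x \<le> u y" if "q \<in> C" for q
      using that by (intro greatest) (simp add: diff_le_eq add.commute[of _ "q x"])
    then have "u (x + y) - u y \<le> u x"
      by (intro greatest) (simp add: algebra_simps)
    then show "u (x + y) \<le> u x + u y" by simp
  next
    have "(\<lambda>q. q 0) ` C = {0}"
      using assms(1) sub sublinear_zero by fastforce
    then show "u 0 = 0"
      by (simp add: u_def)
  next
    fix x and c :: real assume c: "c > 0"
    have "inverse c * u (c *\<^sub>R x) \<le> u x"
    proof (rule greatest)
      fix q assume "q \<in> C"
      then have "u (c *\<^sub>R x) \<le> c * q x"
        using lower[of q "c *\<^sub>R x"] sublinear_scale[OF sub, of q c x] c by simp
      then show "inverse c * u (c *\<^sub>R x) \<le> q x"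
        using c by (simp add: field_simps)
    qed
    then show "u (c *\<^sub>R x) \<le> c * u x"
      using c by (simp add: field_simps)
  qed
qed

text \<open>A minimal sublinear functional \<open>q\<close> equals all its \<open>linearize_at q y\<close>, hence is additive.\<close>

theorem hahn_banach:
  fixes p :: "'a::real_vector \<Rightarrow> real"
  assumes p: "sublinear p"
  obtains f where "linear f" "\<And>x. f x \<le> p x"
proof -
  define A where "A = {q. sublinear q \<and> q \<le> p}"
  \<comment> \<open>Zorn's lemma for the reversed order: a maximal element is a minimal
    functional.\<close>
  have "\<exists>m\<in>A. \<forall>a\<in>A. m \<ge> a \<longrightarrow> a = m"
  proof (rule predicate_Zorn)
    show "partial_order_on A (relation_of (\<ge>) A)"
      by (rule partial_order_on_relation_ofI) auto
  next
    fix C assume C: "C \<in> Chains (relation_of (\<ge>) A)"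
    then have CA: "C \<subseteq> A" by (rule Chains_relation_of)
    show "\<exists>u\<in>A. \<forall>a\<in>C. a \<ge> u"
    proof (cases "C = {}")
      case True
      then show ?thesis using p by (auto simp: A_def)
    next
      case False
      have chain: "q \<le> r \<or> r \<le> q" if "q \<in> C" "r \<in> C" for q r
        using C that unfolding Chains_def relation_of_def by blast
      define u where "u = (\<lambda>x. INF q\<in>C. q x)"
      have props: "sublinear q" "q x \<le> p x" if "q \<in> C" for q x
        using CA that by (auto simp: A_def le_fun_def)
      have "sublinear u"
        unfolding u_def using False props chain by (rule sublinear_chain_Inf(1))
      have u_le: "u \<le> q" if "q \<in> C" for q
        unfolding u_def using False props chain that by (rule sublinear_chain_Inf(2))
      obtain q where "q \<in> C" using False by auto
      then have "u \<le> p"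
        using u_le[of q] props(2)[of q] by (auto simp: le_fun_def intro: order_trans)
      with \<open>sublinear u\<close> have "u \<in> A"
        by (simp add: A_def)
      then show ?thesis using u_le by auto
    qed
  qed
  then obtain q where q: "sublinear q" "q \<le> p"
    and min: "\<And>r. sublinear r \<Longrightarrow> r \<le> q \<Longrightarrow> r = q"
    unfolding A_def by (auto dest: order_trans)
  have eq: "linearize_at q y = q" for y
    by (rule min) (auto simp: le_fun_def q sublinear_linearize_at linearize_at_le)
  \<comment> \<open>The parameter 1 gives \<open>q x \<le> q (x + y) - q y\<close>, the converse of
    subadditivity.\<close>
  have add: "q (x + y) = q x + q y" for x y
    using linearize_at_lower[OF q(1), of 1 y x] sublinear_add[OF q(1), of x y] by (simp add: eq)
  have uminus: "q (- x) = - q x" for x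
    using add[of x "- x"] by (simp add: sublinear_zero[OF q(1)])
  have "linear q"
  proof (rule linearI)
    fix c :: real and x
    show "q (c *\<^sub>R x) = c *\<^sub>R q x"
    proof (cases "c \<ge> 0")
      case True
      then show ?thesis by (simp add: sublinear_scale[OF q(1)])
    next
      case False
      then show ?thesis
        using sublinear_scale[OF q(1), of "- c" x] uminus[of "c *\<^sub>R x"] by simp
    qed
  qed (rule add)
  then show thesis
    using that q(2) by (auto simp: le_fun_def)
qed

text \<open>Domination by the norm linearized at \<open>x\<close> forces
  \<open>f (- x) \<le> - norm x\<close>; this takes the place of an extension from the span of
  \<open>x\<close>.\<close>

corollary norming_functional:
  fixes x :: "'a::real_normed_vector"
  obtains k :: "'a \<Rightarrow>\<^sub>L real" where "norm k \<le> 1" "k x = norm x"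
proof -
  obtain f where f: "linear f" "\<And>z. f z \<le> linearize_at norm x z"
    using hahn_banach[OF sublinear_linearize_at[OF sublinear_norm, of x]] by blast
  have le: "f z \<le> norm z" for z
    using f(2)[of z] linearize_at_le[OF sublinear_norm, of x z] by linarith
  have abs_le: "norm (f z) \<le> norm z * 1" for z
    using le[of z] le[of "- z"] by (simp add: linear_neg[OF f(1)] abs_le_iff)
  have "bounded_linear f"
    using f(1) abs_le by (intro bounded_linear_intro[of f 1]) (auto simp: linear_add linear_scale)
  then have app: "blinfun_apply (Blinfun f) = f"
    by (rule bounded_linear_Blinfun_apply)
  have "f x \<ge> norm x"
    using f(2)[of "- x"] linearize_at_uminus[OF sublinear_norm, of x]
    by (simp add: linear_neg[OF f(1)])
  then have "f x = norm x"
    using le[of x] by simp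
  moreover have "norm (Blinfun f) \<le> 1"
    using abs_le by (intro norm_blinfun_bound) (auto simp: app mult.commute)
  ultimately show thesis
    using that[of "Blinfun f"] by (simp add: app)
qed

section \<open>Generalized limits\<close>

definition seq_limsup :: "(nat \<Rightarrow>\<^sub>C real) \<Rightarrow> real" where
  "seq_limsup x = Inf {c. \<forall>\<^sub>F n in sequentially. apply_bcontfun x n \<le> c}"

lemma seq_limsup_lower:
  assumes "\<forall>\<^sub>F n in sequentially. apply_bcontfun x n \<le> c"
  shows "seq_limsup x \<le> c"
  unfolding seq_limsup_def
proof (rule cInf_lower)
  show "bdd_below {c. \<forall>\<^sub>F n in sequentially. apply_bcontfun x n \<le> c}"
  proof (rule bdd_belowI)
    fix d assume "d \<in> {c. \<forall>\<^sub>F n in sequentially. apply_bcontfun x n \<le> c}"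
    then obtain n where "apply_bcontfun x n \<le> d"
      by (auto simp: eventually_sequentially)
    then show "- norm x \<le> d"
      using norm_bounded[of x n] by simp
  qed
qed (use assms in simp)

lemma seq_limsup_greatest:
  assumes "\<And>c. \<forall>\<^sub>F n in sequentially. apply_bcontfun x n \<le> c \<Longrightarrow> m \<le> c"
  shows "m \<le> seq_limsup x"
  unfolding seq_limsup_def
proof (rule cInf_greatest)
  have "apply_bcontfun x n \<le> norm x" for n
    using norm_bounded[of x n] by simp
  then show "{c. \<forall>\<^sub>F n in sequentially. apply_bcontfun x n \<le> c} \<noteq> {}"
    by (auto intro: exI[of _ "norm x"])
qed (use assms in auto)

lemma sublinear_seq_limsup: "sublinear seq_limsup"
proof (rule sublinearI)
  fix x y :: "nat \<Rightarrow>\<^sub>C real"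
  have "seq_limsup (x + y) - c \<le> seq_limsup y"
    if "\<forall>\<^sub>F n in sequentially. apply_bcontfun x n \<le> c" for c
  proof (rule seq_limsup_greatest)
    fix d assume "\<forall>\<^sub>F n in sequentially. apply_bcontfun y n \<le> d"
    with that have "\<forall>\<^sub>F n in sequentially. apply_bcontfun (x + y) n \<le> c + d"
      by eventually_elim (simp add: plus_bcontfun.rep_eq)
    from seq_limsup_lower[OF this] show "seq_limsup (x + y) - c \<le> d"
      by simp
  qed
  then have "seq_limsup (x + y) - seq_limsup y \<le> seq_limsup x"
    by (intro seq_limsup_greatest) (simp add: algebra_simps)
  then show "seq_limsup (x + y) \<le> seq_limsup x + seq_limsup y"
    by simp
next
  have "{c::real. \<forall>\<^sub>F n::nat in sequentially. 0 \<le> c} = {0..}"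
    by auto
  then show "seq_limsup 0 = 0"
    by (simp add: seq_limsup_def zero_bcontfun.rep_eq)
next
  fix x and c :: real assume c: "c > 0"
  have "inverse c * seq_limsup (c *\<^sub>R x) \<le> seq_limsup x"
  proof (rule seq_limsup_greatest)
    fix d assume "\<forall>\<^sub>F n in sequentially. apply_bcontfun x n \<le> d"
    then have "\<forall>\<^sub>F n in sequentially. apply_bcontfun (c *\<^sub>R x) n \<le> c * d"
      by eventually_elim (use c in \<open>simp add: scaleR_bcontfun.rep_eq\<close>)
    from seq_limsup_lower[OF this] show "inverse c * seq_limsup (c *\<^sub>R x) \<le> d"
      using c by (simp add: field_simps)
  qed
  then show "seq_limsup (c *\<^sub>R x) \<le> c * seq_limsup x"
    using c by (simp add: field_simps)
qed

text \<open>A Hahn--Banach functional dominated by the limit superior, hence a generalized limit of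
  every bounded sequence.\<close>

definition blim :: "(nat \<Rightarrow> real) \<Rightarrow> real" where
  "blim x = (SOME f. linear f \<and> (\<forall>y. f y \<le> seq_limsup y)) (Bcontfun x)"

lemma apply_Bcontfun_seq:
  fixes x :: "nat \<Rightarrow> real"
  assumes "\<And>n. \<bar>x n\<bar> \<le> B"
  shows "apply_bcontfun (Bcontfun x) = x"
proof -
  have "x \<in> bcontfun"
    using assms by (intro bcontfun_normI[of x B]) (auto simp: continuous_on_discrete)
  then show ?thesis by (simp add: Bcontfun_inverse)
qed

lemma blim_functional:
  obtains f where "linear f" "\<And>y. f y \<le> seq_limsup y" "\<And>x. blim x = f (Bcontfun x)"
proof -
  define f where "f = (SOME f. linear f \<and> (\<forall>y. f y \<le> seq_limsup y))"
  obtain g where "linear g" "\<And>y. g y \<le> seq_limsup y"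
    by (rule hahn_banach[OF sublinear_seq_limsup]) blast
  then have "\<exists>f. linear f \<and> (\<forall>y. f y \<le> seq_limsup y)"
    by blast
  then have "linear f \<and> (\<forall>y. f y \<le> seq_limsup y)"
    unfolding f_def by (rule someI_ex)
  then show thesis
    using that[of f] by (simp add: blim_def f_def)
qed

lemma blim_add:
  fixes x y :: "nat \<Rightarrow> real"
  assumes "\<And>n. \<bar>x n\<bar> \<le> B" "\<And>n. \<bar>y n\<bar> \<le> B'"
  shows "blim (\<lambda>n. x n + y n) = blim x + blim y"
proof -
  obtain f where f: "linear f" "\<And>x. blim x = f (Bcontfun x)"
    by (rule blim_functional) blast
  have "Bcontfun (\<lambda>n. x n + y n) = Bcontfun x + Bcontfun y"
    by (simp add: plus_bcontfun_def apply_Bcontfun_seq[of x, OF assms(1)]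
        apply_Bcontfun_seq[of y, OF assms(2)])
  then show ?thesis
    by (simp add: f(2) linear_add[OF f(1)])
qed

lemma blim_cmult:
  fixes x :: "nat \<Rightarrow> real"
  assumes "\<And>n. \<bar>x n\<bar> \<le> B"
  shows "blim (\<lambda>n. c * x n) = c * blim x"
proof -
  obtain f where f: "linear f" "\<And>x. blim x = f (Bcontfun x)"
    by (rule blim_functional) blast
  have "Bcontfun (\<lambda>n. c * x n) = c *\<^sub>R Bcontfun x"
    by (simp add: scaleR_bcontfun_def apply_Bcontfun_seq[of x, OF assms])
  then show ?thesis
    by (simp add: f(2) linear_scale[OF f(1)])
qed

text \<open>Domination by the limit superior, applied to the negated sequence, becomes a lower
  bound.\<close>

lemma blim_ge:
  fixes x :: "nat \<Rightarrow> real"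
  assumes "\<And>n. \<bar>x n\<bar> \<le> B" and "\<forall>\<^sub>F n in sequentially. c \<le> x n"
  shows "c \<le> blim x"
proof -
  obtain f where f: "linear f" "\<And>y. f y \<le> seq_limsup y" "\<And>x. blim x = f (Bcontfun x)"
    by (rule blim_functional) blast
  have "seq_limsup (- Bcontfun x) \<le> - c"
    using assms(2)
    by (intro seq_limsup_lower) (simp add: uminus_bcontfun.rep_eq apply_Bcontfun_seq[OF assms(1)])
  then show ?thesis
    using f(2)[of "- Bcontfun x"] by (simp add: f(3) linear_neg[OF f(1)])
qed

lemma blim_le:
  fixes x :: "nat \<Rightarrow> real"
  assumes "\<And>n. \<bar>x n\<bar> \<le> B" and "\<forall>\<^sub>F n in sequentially. x n \<le> c"
  shows "blim x \<le> c"
  using blim_ge[of "\<lambda>n. - 1 * x n" B "- c"] blim_cmult[of x B "- 1"] assms by simp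

lemma blim_const: "blim (\<lambda>n. c) = c"
proof (rule antisym)
  show "blim (\<lambda>n. c) \<le> c"
    by (rule blim_le[of _ "\<bar>c\<bar>"]) simp_all
  show "c \<le> blim (\<lambda>n. c)"
    by (rule blim_ge[of _ "\<bar>c\<bar>"]) simp_all
qed

text \<open>Turns a bound on a limit into a bound at an index as far out as desired: otherwise
  \<open>c\<close> would be an eventual lower bound.\<close>

lemma blim_less_ex:
  fixes x :: "nat \<Rightarrow> real"
  assumes "\<And>n. \<bar>x n\<bar> \<le> B" and "blim x < c"
  obtains n where "N \<le> n" "x n < c"
proof -
  have "\<not> (\<forall>\<^sub>F n in sequentially. c \<le> x n)"
    using blim_ge[of x B c] assms by auto
  then show thesis
    using that by (auto simp: eventually_sequentially not_le)
qed

section \<open>Weak generalized limits\<close>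

lemma abs_blinfun_apply_le:
  fixes k :: "'a::real_normed_vector \<Rightarrow>\<^sub>L real"
  assumes "norm k \<le> B" "norm x \<le> C"
  shows "\<bar>k x\<bar> \<le> B * C"
proof -
  have "\<bar>k x\<bar> \<le> norm k * norm x"
    using norm_blinfun[of k x] by simp
  also have "\<dots> \<le> B * C"
    using assms by (intro mult_mono) (auto intro: order_trans[OF norm_ge_zero])
  finally show ?thesis .
qed

text \<open>A weak-star generalized limit: the pointwise \<open>blim\<close> inherits linearity and
  the norm bound.\<close>

lemma dual_blim_ex:
  fixes g :: "nat \<Rightarrow> 'a::real_normed_vector \<Rightarrow>\<^sub>L real"
  assumes g: "\<And>n. norm (g n) \<le> B"
  shows "\<exists>h. norm h \<le> B \<and> (\<forall>x. blinfun_apply h x = blim (\<lambda>n. g n x))"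
proof -
  have bd: "\<bar>g n x\<bar> \<le> B * norm x" for n x
    using abs_blinfun_apply_le[OF g] by blast
  have "B \<ge> 0"
    using g[of 0] norm_ge_zero order_trans by blast
  define f where "f x = blim (\<lambda>n. g n x)" for x
  have le: "norm (f x) \<le> norm x * B" for x
  proof -
    have "f x \<le> B * norm x"
      unfolding f_def using bd[of _ x] by (intro blim_le[OF bd]) (auto simp: abs_le_iff)
    moreover have "- (B * norm x) \<le> f x"
      unfolding f_def using bd[of _ x]
      by (intro blim_ge[OF bd]) (auto simp: abs_le_iff minus_le_iff)
    ultimately show ?thesis by (simp add: mult.commute abs_le_iff)
  qed
  have "bounded_linear f"
  proof (rule bounded_linear_intro[OF _ _ le])
    show "f (x + y) = f x + f y" for x y
      unfolding f_def by (simp add: blinfun.add_right blim_add[OF bd bd])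
    show "f (c *\<^sub>R x) = c *\<^sub>R f x" for c x
      unfolding f_def by (simp add: blinfun.scaleR_right blim_cmult[OF bd])
  qed
  then have app: "blinfun_apply (Blinfun f) = f"
    by (rule bounded_linear_Blinfun_apply)
  have "norm (Blinfun f x) \<le> B * norm x" for x
    using le[of x] by (simp add: app mult.commute)
  then have "norm (Blinfun f) \<le> B"
    by (rule norm_blinfun_bound[OF \<open>B \<ge> 0\<close>])
  then show ?thesis
    by (intro exI[of _ "Blinfun f"]) (simp add: app f_def)
qed

lemma norm_bidual_embedding_le: "norm (bidual_embedding x) \<le> norm x"
proof (rule norm_blinfun_bound)
  show "norm (bidual_embedding x k) \<le> norm x * norm k" for k
    using norm_blinfun[of k x] by (simp add: bidual_embedding.rep_eq mult.commute)
qed simp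

text \<open>The limit is taken in the bidual and pulled back by reflexivity; a norming functional of
  \<open>w\<close> carries the norm bound over.\<close>

lemma weak_blim_ex:
  fixes x :: "nat \<Rightarrow> 'e::real_normed_vector"
  assumes refl: "reflexive_space TYPE('e)" and x: "\<And>n. norm (x n) \<le> B"
  shows "\<exists>w. norm w \<le> B \<and> (\<forall>k. blinfun_apply k w = blim (\<lambda>n. k (x n)))"
proof -
  have "norm (bidual_embedding (x n)) \<le> B" for n
    by (rule order_trans[OF norm_bidual_embedding_le x])
  then obtain h where h: "\<And>k. blinfun_apply h k = blim (\<lambda>n. bidual_embedding (x n) k)"
    using dual_blim_ex[of "\<lambda>n. bidual_embedding (x n)" B] by blast
  obtain w where "h = bidual_embedding w"
    using refl unfolding reflexive_space_def by (metis surjD)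
  then have w: "blinfun_apply k w = blim (\<lambda>n. k (x n))" for k
    using h[of k] by (simp add: bidual_embedding.rep_eq)
  obtain k :: "'e \<Rightarrow>\<^sub>L real" where k: "norm k \<le> 1" "k w = norm w"
    by (rule norming_functional)
  have bd: "\<bar>k (x n)\<bar> \<le> B" for n
    using abs_blinfun_apply_le[OF k(1) x] by simp
  have "norm w \<le> B"
    unfolding k(2)[symmetric] w using bd by (intro blim_le[OF bd]) (auto simp: abs_le_iff)
  then show ?thesis using w by blast
qed

text \<open>The choice below is meaningful only for bounded sequences, and for \<open>weak_blim\<close> only in a
  reflexive space.\<close>

definition dual_blim :: "(nat \<Rightarrow> 'a::real_normed_vector \<Rightarrow>\<^sub>L real) \<Rightarrow> 'a \<Rightarrow>\<^sub>L real" where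
  "dual_blim g = (SOME h. norm h \<le> (SUP n. norm (g n)) \<and> (\<forall>x. blinfun_apply h x = blim (\<lambda>n. g n x)))"

definition weak_blim :: "(nat \<Rightarrow> 'a::real_normed_vector) \<Rightarrow> 'a" where
  "weak_blim x = (SOME w. norm w \<le> (SUP n. norm (x n)) \<and> (\<forall>k. blinfun_apply k w = blim (\<lambda>n. k (x n))))"

text \<open>The limits are chosen relative to the supremum so that the choice does not depend on
  \<open>B\<close>; this passes between the two bounds.\<close>

lemma norm_le_SUP:
  fixes x :: "nat \<Rightarrow> 'a::real_normed_vector"
  assumes "\<And>n. norm (x n) \<le> B"
  shows "norm (x n) \<le> (SUP n. norm (x n))" "(SUP n. norm (x n)) \<le> B"
proof -
  have "bdd_above (range (\<lambda>n. norm (x n)))"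
    using assms by (rule bdd_aboveI2)
  then show "norm (x n) \<le> (SUP n. norm (x n))"
    by (intro cSUP_upper) auto
  show "(SUP n. norm (x n)) \<le> B"
    using assms by (intro cSUP_least) auto
qed

lemma dual_blim:
  fixes g :: "nat \<Rightarrow> 'a::real_normed_vector \<Rightarrow>\<^sub>L real"
  assumes "\<And>n. norm (g n) \<le> B"
  shows "norm (dual_blim g) \<le> B" and "blinfun_apply (dual_blim g) x = blim (\<lambda>n. g n x)"
  using someI_ex[OF dual_blim_ex[of g "SUP n. norm (g n)", OF norm_le_SUP(1)[OF assms]]]
    norm_le_SUP(2)[of g, OF assms]
  unfolding dual_blim_def[symmetric] by auto

lemma weak_blim:
  fixes x :: "nat \<Rightarrow> 'e::real_normed_vector"
  assumes "reflexive_space TYPE('e)" and "\<And>n. norm (x n) \<le> B"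
  shows "norm (weak_blim x) \<le> B" and "blinfun_apply k (weak_blim x) = blim (\<lambda>n. k (x n))"
  using someI_ex[OF weak_blim_ex[of x "SUP n. norm (x n)", OF assms(1) norm_le_SUP(1)[OF assms(2)]]]
    norm_le_SUP(2)[of x, OF assms(2)]
  unfolding weak_blim_def[symmetric] by auto

section \<open>Kalton's interlacing argument\<close>

text \<open>With \<open>L\<close> a limit operator, \<open>iterate_lim L r f \<sigma>\<close> is the iterated limit, over
  \<open>n\<^sub>r\<close>, \<open>\<dots>\<close>, \<open>n\<^sub>1\<close> in this order, of \<open>f (\<sigma> @ [n\<^sub>1, \<dots>, n\<^sub>r])\<close>.\<close>

primrec iterate_lim :: "((nat \<Rightarrow> 'a) \<Rightarrow> 'a) \<Rightarrow> nat \<Rightarrow> (nat list \<Rightarrow> 'a) \<Rightarrow> nat list \<Rightarrow> 'a" where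
  "iterate_lim L 0 f \<sigma> = f \<sigma>"
| "iterate_lim L (Suc r) f \<sigma> = L (\<lambda>n. iterate_lim L r f (\<sigma> @ [n]))"

text \<open>The entries form one strictly increasing chain, alternating and starting in the first
  list. The threshold \<open>N\<close> carries the order through the recursion and pushes tuples far
  out.\<close>

fun interlaced :: "nat \<Rightarrow> nat list \<Rightarrow> nat list \<Rightarrow> bool" where
  "interlaced N [] [] \<longleftrightarrow> True"
| "interlaced N (x # a) (y # b) \<longleftrightarrow> N \<le> x \<and> x < y \<and> interlaced (Suc y) a b"
| "interlaced N _ _ \<longleftrightarrow> False"

lemma norm_iterate_dual_blim:
  fixes g :: "nat list \<Rightarrow> 'a::real_normed_vector \<Rightarrow>\<^sub>L real"
  assumes "\<And>\<sigma>. norm (g \<sigma>) \<le> B"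
  shows "norm (iterate_lim dual_blim r g \<sigma>) \<le> B"
  by (induction r arbitrary: \<sigma>) (simp_all add: assms dual_blim(1))

lemma norm_iterate_weak_blim:
  fixes f :: "nat list \<Rightarrow> 'e::real_normed_vector"
  assumes "reflexive_space TYPE('e)" and "\<And>\<sigma>. norm (f \<sigma>) \<le> B"
  shows "norm (iterate_lim weak_blim r f \<sigma>) \<le> B"
  by (induction r arbitrary: \<sigma>) (simp_all add: assms weak_blim(1))

text \<open>The two iterated limits are unwound alternately, an index of \<open>g\<close> and then a
  later index of \<open>f\<close>; the prefixes \<open>\<tau>\<close> and \<open>\<sigma>\<close>
  record the indices already chosen.\<close>

lemma interlaced_extraction:
  fixes f :: "nat list \<Rightarrow> 'e::real_normed_vector" and g :: "nat list \<Rightarrow> 'e \<Rightarrow>\<^sub>L real"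
  assumes refl: "reflexive_space TYPE('e)"
    and f: "\<And>\<sigma>. norm (f \<sigma>) \<le> B" and g: "\<And>\<sigma>. norm (g \<sigma>) \<le> C"
    and "iterate_lim dual_blim r g \<tau> (iterate_lim weak_blim r f \<sigma> - u) < c"
  obtains a b where "interlaced N a b" "length a = r" "length b = r" "g (\<tau> @ a) (f (\<sigma> @ b) - u) < c"
  using assms(4)
proof (induction r arbitrary: \<sigma> \<tau> N thesis)
  case 0
  then show ?case by (metis append_Nil2 interlaced.simps(1) iterate_lim.simps(1) list.size(3))
next
  case (Suc r)
  define F where "F = iterate_lim weak_blim r f"
  define G where "G = iterate_lim dual_blim r g"
  define w where "w = weak_blim (\<lambda>m. F (\<sigma> @ [m]))"
  have G: "norm (G \<rho>) \<le> C" for \<rho>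
    unfolding G_def using g by (rule norm_iterate_dual_blim)
  have F: "norm (F \<rho>) \<le> B" for \<rho>
    unfolding F_def using refl f by (rule norm_iterate_weak_blim)
  \<comment> \<open>The outer dual limit is opened first, with the vector \<open>w - u\<close> held
    fixed.\<close>
  have "blim (\<lambda>n. G (\<tau> @ [n]) (w - u)) < c"
    using Suc.prems(2) dual_blim(2)[of "\<lambda>n. G (\<tau> @ [n])", OF G]
    by (simp add: w_def G_def F_def)
  then obtain n where n: "N \<le> n" "G (\<tau> @ [n]) (w - u) < c"
    using blim_less_ex[of "\<lambda>n. G (\<tau> @ [n]) (w - u)", OF abs_blinfun_apply_le[OF G order_refl]]
    by blast
  define k where "k = G (\<tau> @ [n])"
  have kF: "\<bar>k (F (\<sigma> @ [m]))\<bar> \<le> C * B" for m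
    unfolding k_def using G F by (rule abs_blinfun_apply_le)
  \<comment> \<open>With the functional \<open>k\<close> now fixed, the outer weak limit inside
    \<open>w\<close> is opened.\<close>
  have "blim (\<lambda>m. k (F (\<sigma> @ [m]) - u)) = blim (\<lambda>m. k (F (\<sigma> @ [m]))) + blim (\<lambda>m. - k u)"
    using blim_add[of "\<lambda>m. k (F (\<sigma> @ [m]))" "C * B" "\<lambda>m. - k u" "\<bar>k u\<bar>", OF kF]
    by (simp add: blinfun.diff_right)
  also have "\<dots> = k (w - u)"
    using weak_blim(2)[of "\<lambda>m. F (\<sigma> @ [m])", OF refl F]
    by (simp add: w_def blim_const blinfun.diff_right)
  finally have "blim (\<lambda>m. k (F (\<sigma> @ [m]) - u)) < c"
    using n(2) by (simp add: k_def)
  moreover have "\<bar>k (F (\<sigma> @ [m]) - u)\<bar> \<le> C * B + \<bar>k u\<bar>" for m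
    using kF[of m] by (simp add: blinfun.diff_right)
  \<comment> \<open>Starting from \<open>Suc n\<close> puts \<open>m\<close> beyond
    \<open>n\<close>; the tails are then sought beyond \<open>m\<close>.\<close>
  ultimately obtain m where m: "Suc n \<le> m" "k (F (\<sigma> @ [m]) - u) < c"
    using blim_less_ex[of "\<lambda>m. k (F (\<sigma> @ [m]) - u)" "C * B + \<bar>k u\<bar>" c "Suc n"] by blast
  obtain a b where ab: "interlaced (Suc m) a b" "length a = r" "length b = r"
      "g ((\<tau> @ [n]) @ a) (f ((\<sigma> @ [m]) @ b) - u) < c"
    using Suc.IH[where \<tau> = "\<tau> @ [n]" and \<sigma> = "\<sigma> @ [m]" and N = "Suc m"] m(2) by (auto simp: k_def G_def F_def)
  show ?case
    by (rule Suc.prems(1)[of "n # a" "m # b"]) (use ab n(1) m(1) in auto)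
qed

text \<open>The norming functional of \<open>f \<sigma> - u\<close> is tested against \<open>f \<tau> - u\<close> for \<open>\<tau>\<close> interlaced
  with \<open>\<sigma>\<close>; as \<open>u\<close> is the iterated limit of \<open>f\<close>, these pairings have iterated limit \<open>0\<close>.\<close>

lemma interlaced_concentration:
  fixes f :: "nat list \<Rightarrow> 'e::real_normed_vector"
  assumes refl: "reflexive_space TYPE('e)"
    and f: "\<And>\<sigma>. norm (f \<sigma>) \<le> B"
    and lip: "\<And>N a b. interlaced N a b \<Longrightarrow> length a = r \<Longrightarrow> dist (f a) (f b) \<le> C"
    and e: "e > 0"
  obtains u where "\<And>N. \<exists>a b. interlaced N a b \<and> length a = r \<and> dist (f a) u < C + e"
proof
  fix N
  define u where "u = iterate_lim weak_blim r f []"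
  have "\<exists>k :: 'e \<Rightarrow>\<^sub>L real. norm k \<le> 1 \<and> blinfun_apply k (f \<sigma> - u) = norm (f \<sigma> - u)" for \<sigma>
    by (rule norming_functional) blast
  then obtain g :: "nat list \<Rightarrow> 'e \<Rightarrow>\<^sub>L real"
    where g: "\<And>\<sigma>. norm (g \<sigma>) \<le> 1" "\<And>\<sigma>. g \<sigma> (f \<sigma> - u) = norm (f \<sigma> - u)"
    by metis
  \<comment> \<open>By the choice of \<open>u\<close> the functional is evaluated at 0.\<close>
  have "iterate_lim dual_blim r g [] (iterate_lim weak_blim r f [] - u) < e"
    using e by (simp add: u_def)
  then obtain a b where ab: "interlaced N a b" "length a = r" "g ([] @ a) (f ([] @ b) - u) < e"
    by (rule interlaced_extraction[OF refl f g(1)]) blast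
  \<comment> \<open>Passing through \<open>f b\<close> leaves a term bounded by \<open>lip\<close>
    and the small pairing just extracted.\<close>
  have "dist (f a) u = g a (f a - f b) + g a (f b - u)"
    unfolding dist_norm g(2)[symmetric] by (simp add: blinfun.diff_right)
  moreover have "g a (f a - f b) \<le> C"
    using abs_blinfun_apply_le[OF g(1), of "f a - f b" C a] lip[OF ab(1,2)]
    by (simp add: dist_norm)
  ultimately have "dist (f a) u < C + e"
    using ab(3) by simp
  then show "\<exists>a b. interlaced N a b \<and> length a = r \<and> dist (f a) (iterate_lim weak_blim r f []) < C + e"
    using ab unfolding u_def by blast
qed

section \<open>Sums of the summing basis\<close>

text \<open>\<open>step_sum [n\<^sub>1, \<dots>, n\<^sub>r]\<close> is \<open>s n\<^sub>1 + \<dots> + s n\<^sub>r\<close>, with \<open>s n\<close> the indicator of \<open>{..<n}\<close>.\<close>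

definition step_sum :: "nat list \<Rightarrow> nat \<Rightarrow>\<^sub>C real" where
  "step_sum a = Bcontfun (\<lambda>j. real (length (filter (\<lambda>m. j < m) a)))"

lemma step_sum_apply: "apply_bcontfun (step_sum a) j = real (length (filter (\<lambda>m. j < m) a))"
proof -
  have "apply_bcontfun (step_sum a) = (\<lambda>j. real (length (filter (\<lambda>m. j < m) a)))"
    unfolding step_sum_def by (rule apply_Bcontfun_seq[of _ "real (length a)"]) simp
  then show ?thesis by simp
qed

lemma step_sum_in_c0: "step_sum a \<in> c0"
proof -
  \<comment> \<open>The sum of the entries serves as an upper bound for each of them.\<close>
  have "filter (\<lambda>m. j < m) a = []" if "j \<ge> sum_list a" for j
    using that member_le_sum_list[of _ a] by (fastforce simp: filter_empty_conv)
  then have "\<forall>\<^sub>F j in sequentially. apply_bcontfun (step_sum a) j = 0"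
    unfolding eventually_sequentially by (intro exI[of _ "sum_list a"]) (simp add: step_sum_apply)
  then show ?thesis
    unfolding c0_def by (simp add: tendsto_eventually)
qed

lemma interlaced_length: "interlaced N a b \<Longrightarrow> length a = length b"
  by (induction N a b rule: interlaced.induct) auto

lemma interlaced_filter:
  assumes "interlaced N a b" "j < N"
  shows "filter (\<lambda>m. j < m) a = a" "filter (\<lambda>m. j < m) b = b"
  using assms by (induction N a b rule: interlaced.induct) auto

text \<open>Each entry of \<open>a\<close> is followed by its partner in \<open>b\<close> before the
  next entry of \<open>a\<close>, so a cut at \<open>j\<close> separates at most one pair.\<close>

lemma interlaced_count:
  assumes "interlaced N a b"
  shows "length (filter (\<lambda>m. j < m) a) \<le> length (filter (\<lambda>m. j < m) b)
    \<and> length (filter (\<lambda>m. j < m) b) \<le> Suc (length (filter (\<lambda>m. j < m) a))"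
  using assms
proof (induction N a b rule: interlaced.induct)
  case (2 N x a y b)
  show ?case
  proof (cases "x \<le> j \<and> j < y")
    \<comment> \<open>The cut falls inside the first pair: both tails lie beyond \<open>j\<close>
      and have equal length, so the counts differ by exactly one.\<close>
    case True
    then show ?thesis
      using 2 interlaced_filter[of "Suc y" a b j] interlaced_length[of "Suc y" a b] by simp
  next
    case False
    then show ?thesis using 2 by auto
  qed
qed auto

lemma dist_step_sum_interlaced:
  assumes "interlaced N a b"
  shows "dist (step_sum a) (step_sum b) \<le> 1"
proof (rule dist_bound)
  show "dist (apply_bcontfun (step_sum a) j) (apply_bcontfun (step_sum b) j) \<le> 1" for j
    using interlaced_count[OF assms, of j] by (simp add: step_sum_apply dist_real_def)
qed

lemma dist_step_sum_le:
  assumes "length a \<le> r" "length b \<le> r"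
  shows "dist (step_sum a) (step_sum b) \<le> real r"
proof (rule dist_bound)
  fix j
  have "length (filter (\<lambda>m. j < m) a) \<le> r" "length (filter (\<lambda>m. j < m) b) \<le> r"
    using assms length_filter_le order_trans by blast+
  then show "dist (apply_bcontfun (step_sum a) j) (apply_bcontfun (step_sum b) j) \<le> real r"
    by (simp add: step_sum_apply dist_real_def)
qed

text \<open>The coordinate \<open>sum_list a\<close> lies below all entries of \<open>a'\<close> and
  below none of \<open>a\<close>, so the values there are \<open>r\<close> and 0.\<close>

lemma dist_step_sum_separated:
  assumes "interlaced (Suc (sum_list a)) a' b'" "length a = r" "length a' = r"
  shows "dist (step_sum a) (step_sum a') = real r"
proof (rule antisym)
  show "dist (step_sum a) (step_sum a') \<le> real r"
    using assms by (intro dist_step_sum_le) auto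
  have "filter (\<lambda>m. sum_list a < m) a = []"
    using member_le_sum_list[of _ a] by (fastforce simp: filter_empty_conv)
  then have "dist (apply_bcontfun (step_sum a) (sum_list a)) (apply_bcontfun (step_sum a') (sum_list a))
      = real r"
    using interlaced_filter(1)[OF assms(1), of "sum_list a"] assms(3)
    by (simp add: step_sum_apply dist_real_def)
  then show "real r \<le> dist (step_sum a) (step_sum a')"
    using dist_bounded[of "step_sum a" "sum_list a" "step_sum a'"] by simp
qed

section \<open>Bornologous maps on \<open>c\<^sub>0\<close>\<close>

lemma bornologous_onE:
  assumes "bornologous_on X \<phi>"
  obtains C where "\<And>x y. x \<in> X \<Longrightarrow> y \<in> X \<Longrightarrow> dist x y \<le> t \<Longrightarrow> dist (\<phi> x) (\<phi> y) \<le> C"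
  using assms unfolding bornologous_on_def bdd_above_def by blast

text \<open>The image bound depends only on \<open>C\<close>, while \<open>r\<close> is arbitrary;
  this is what contradicts solvency.\<close>

lemma bornologous_c0_small_distance:
  fixes \<phi> :: "(nat \<Rightarrow>\<^sub>C real) \<Rightarrow> 'e::real_normed_vector"
  assumes refl: "reflexive_space TYPE('e)" and born: "bornologous_on c0 \<phi>"
    and C: "\<And>x y. x \<in> c0 \<Longrightarrow> y \<in> c0 \<Longrightarrow> dist x y \<le> 1 \<Longrightarrow> dist (\<phi> x) (\<phi> y) \<le> C"
  obtains x y where "x \<in> c0" "y \<in> c0" "dist x y = real r" "dist (\<phi> x) (\<phi> y) < 2 * C + 2"
proof -
  \<comment> \<open>Truncation makes \<open>f\<close> bounded on all lists and changes nothing at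
    length \<open>r\<close>.\<close>
  define f where "f a = \<phi> (step_sum (take r a))" for a
  \<comment> \<open>\<open>D\<close> may depend on \<open>r\<close>: it only bounds
    \<open>f\<close>, so that the weak limits exist.\<close>
  obtain D where D: "\<And>x y. x \<in> c0 \<Longrightarrow> y \<in> c0 \<Longrightarrow> dist x y \<le> real r \<Longrightarrow> dist (\<phi> x) (\<phi> y) \<le> D"
    using bornologous_onE[OF born] by blast
  have bound: "norm (f a) \<le> norm (f []) + D" for a
  proof -
    have "dist (f a) (f []) \<le> D"
      unfolding f_def by (intro D step_sum_in_c0 dist_step_sum_le) auto
    then show ?thesis
      using norm_triangle_sub[of "f a" "f []"] by (simp add: dist_norm)
  qed
  have lip: "dist (f a) (f b) \<le> C" if "interlaced N a b" "length a = r" for N a b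
    using C[OF step_sum_in_c0 step_sum_in_c0 dist_step_sum_interlaced[OF that(1)]]
      interlaced_length[OF that(1)] that(2) by (simp add: f_def)
  obtain u where u: "\<And>N. \<exists>a b. interlaced N a b \<and> length a = r \<and> dist (f a) u < C + 1"
    by (rule interlaced_concentration[where f = f and r = r and C = C and e = 1, OF refl bound])
      (auto intro: lip)
  obtain a where a: "length a = r" "dist (f a) u < C + 1"
    using u by blast
  \<comment> \<open>The threshold places the second tuple beyond every entry of
    \<open>a\<close>.\<close>
  obtain a' b' where a': "interlaced (Suc (sum_list a)) a' b'" "length a' = r" "dist (f a') u < C + 1"
    using u by blast
  have "dist (f a) (f a') < 2 * C + 2"
    using a(2) a'(3) dist_triangle2[of "f a" "f a'" u] by linarith
  then show thesis
    using that[OF step_sum_in_c0 step_sum_in_c0 dist_step_sum_separated[OF a'(1) a(1) a'(2)]] a(1) a'(2)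
    by (simp add: f_def)
qed

theorem theorem64:
  fixes \<phi> :: "(nat \<Rightarrow>\<^sub>C real) \<Rightarrow> 'e::banach"
  assumes "reflexive_space TYPE('e)"
    and "bornologous_on c0 \<phi>"
  shows "insolvent_on c0 \<phi>"
  unfolding insolvent_on_def
proof
  assume solvent: "solvent_on c0 \<phi>"
  obtain C where C: "\<And>x y. x \<in> c0 \<Longrightarrow> y \<in> c0 \<Longrightarrow> dist x y \<le> 1 \<Longrightarrow> dist (\<phi> x) (\<phi> y) \<le> C"
    using bornologous_onE[OF assms(2)] by blast
  \<comment> \<open>Solvency at this \<open>n\<close> demands image distances of at least
    \<open>2 * C + 2\<close>.\<close>
  define n where "n = Suc (nat \<lceil>2 * C + 2\<rceil>)"
  have n: "n \<ge> 1" "2 * C + 2 \<le> real n"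
    unfolding n_def by linarith+
  obtain R where R: "R \<ge> 0"
    "\<And>x y. x \<in> c0 \<Longrightarrow> y \<in> c0 \<Longrightarrow> R \<le> dist x y \<Longrightarrow> dist x y \<le> R + real n \<Longrightarrow> real n \<le> dist (\<phi> x) (\<phi> y)"
    using solvent n(1) unfolding solvent_on_def by blast
  \<comment> \<open>Rounding \<open>R\<close> up stays within the window \<open>[R, R + n]\<close>
    because \<open>n \<ge> 1\<close>.\<close>
  define r where "r = nat \<lceil>R\<rceil>"
  have r: "R \<le> real r" "real r \<le> R + real n"
    using R(1) n(1) unfolding r_def by linarith+
  obtain x y where "x \<in> c0" "y \<in> c0" "dist x y = real r" "dist (\<phi> x) (\<phi> y) < 2 * C + 2"
    using bornologous_c0_small_distance[OF assms C] by blast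
  with R(2)[of x y] r n(2) show False
    by simp
qed

end
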